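(* Let $E/K(C)$ be an elliptic curve, let $\mathcal{C}$ be a strongly semistable model of $C$, and suppose that $E$ has good reduction on a subgraph $T$ of $\Sigma(\mathcal{C})$. Then $E$ also has good reduction on the corresponding complete subgraph $\tilde{T}$, i.e. the subgraph consisting of $T$ together with all endpoints of edges in $T$.
   Context: $K$ is a complete discretely valued field of characteristic $0$ with valuation ring $R$, uniformizer $\pi$, $v(\pi)=1$, and algebraically closed residue field $k$. $C$ is a smooth, projective, geometrically irreducible curve over $K$ with function field $K(C)$. A strongly semistable model $\mathcal{C}$ of $C$ over $R$ is a semistable model such that the irreducible components of $\mathcal{C}_s$ are smooth. Its dual intersection graph $\Sigma(\mathcal{C})$ has one vertex per irreducible component of $\mathcal{C}_s$ and one edge per intersection point of components. The length of the edge corresponding to $z$ is the integer $n$ with $\hat{\mathcal{O}}_{\mathcal{C},z}\simeq R[[x,y]]/(xy-\pi^n)$. For a component $\Gamma$, $v_\Gamma$ is the valuation of $K(C)$ at its generic point, normalized by $v_\Gamma(\pi)=1$. Suppose $\mathcal{C}$ is regular. For $f\in K(C)^*$ the normalized Laplacian $\phi_f$ is the function $\Gamma\mapsto v_\Gamma(f)$ on the vertices of $\Sigma(\mathcal{C})$, extended by linear interpolation to the metrized graph $\overline{\Sigma}(\mathcal{C})$ (each edge viewed as $[0,1]$). A subgraph $T$ is a set of vertices and edges; an edge in $T$ contributes the open interval to the image $\overline{T}\subset\overline{\Sigma}(\mathcal{C})$, its endpoints being in $T$ only if listed as vertices. "$\phi_f=0$ on $T$" means the extended function vanishes at every point of $\overline{T}$.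 Let $S=\{v_\Gamma\}$. An $S$-minimal Weierstrass model of $E$ is a Weierstrass equation with coefficients $a_i\in K(C)$ such that for every $\Gamma$: $v_\Gamma(a_i)\ge0$ and $v_\Gamma(\Delta)$ is minimal among all Weierstrass equations of $E$ integral at $v_\Gamma$. With $\Delta$ the discriminant of an $S$-minimal model, $E$ has good reduction on $T$ if $\phi_\Delta=0$ on $T$. If $\mathcal{C}$ is not regular, the reduction type on $T$ is defined to be that on the induced subgraph of the minimal desingularization of $\mathcal{C}$ (every edge of length $n$ is subdivided into $n$ edges of length $1$, with the $n-1$ new vertices included). *)

theory Defs
  imports "HOL-Analysis.Abstract_Topology" "HOL-Algebra.Ideal_Product" "HOL-Algebra.Generated_Rings"
    "HOL-Algebra.Algebraic_Closure_Type"
begin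

section \<open>Rings\<close>

text \<open>A subset of an ambient field, viewed as a ring with the operations of the field.\<close>

definition sub_ring :: "'f::field set \<Rightarrow> 'f ring" where
  "sub_ring A = ring_of_type_algebra\<lparr>carrier := A\<rparr>"

definition local_ring :: "('a, 'b) ring_scheme \<Rightarrow> bool" where
  "local_ring A \<longleftrightarrow> cring A \<and> (\<exists>!M. maximalideal M A)"

text \<open>In a local ring the maximal ideal is the set of non-units.\<close>

definition max_ideal :: "('a, 'b) ring_scheme \<Rightarrow> 'a set" where
  "max_ideal A = carrier A - Units A"

definition reduced_ring :: "('a, 'b) ring_scheme \<Rightarrow> bool" where
  "reduced_ring A \<longleftrightarrow> (\<forall>a\<in>carrier A. \<forall>n::nat. a [^]\<^bsub>A\<^esub> n = \<zero>\<^bsub>A\<^esub> \<longrightarrow> a = \<zero>\<^bsub>A\<^esub>)"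

text \<open>There is a strictly increasing chain of prime ideals with \<open>d\<close> inclusions.\<close>

definition prime_chain :: "('a, 'b) ring_scheme \<Rightarrow> nat \<Rightarrow> bool" where
  "prime_chain A d \<longleftrightarrow>
     (\<exists>P. (\<forall>i\<le>d. primeideal (P i) A) \<and> (\<forall>i<d. P i \<subset> P (Suc i)))"

definition has_krull_dim :: "('a, 'b) ring_scheme \<Rightarrow> nat \<Rightarrow> bool" where
  "has_krull_dim A d \<longleftrightarrow> prime_chain A d \<and> \<not> prime_chain A (Suc d)"

definition regular_local_ring :: "('a, 'b) ring_scheme \<Rightarrow> bool" where
  "regular_local_ring A \<longleftrightarrow> noetherian_ring A \<and> local_ring A \<and>
     (\<exists>d. has_krull_dim A d \<and>
        (\<exists>G\<subseteq>carrier A. finite G \<and> card G \<le> d \<and> max_ideal A = genideal A G))"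

definition dvr :: "('a, 'b) ring_scheme \<Rightarrow> bool" where
  "dvr A \<longleftrightarrow> principal_domain A \<and> local_ring A \<and> \<not> Ring.field A"

definition uniformizer :: "('a, 'b) ring_scheme \<Rightarrow> 'a \<Rightarrow> bool" where
  "uniformizer A t \<longleftrightarrow> t \<in> carrier A \<and> max_ideal A = genideal A {t}"

text \<open>The valuation, with value group the integers, of a discrete valuation ring \<open>A\<close> whose field
  of fractions is the ambient field; only meaningful on nonzero arguments.\<close>

definition dvr_ord :: "'f::field set \<Rightarrow> 'f \<Rightarrow> int" where
  "dvr_ord A f =
     (THE n. \<exists>t u. uniformizer (sub_ring A) t \<and> u \<in> Units (sub_ring A) \<and> f = u * t powi n)"

primrec ideal_power :: "('a, 'b) ring_scheme \<Rightarrow> 'a set \<Rightarrow> nat \<Rightarrow> 'a set" where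
  "ideal_power A I 0 = carrier A"
| "ideal_power A I (Suc n) = I \<cdot>\<^bsub>A\<^esub> ideal_power A I n"

text \<open>The completion of a local ring \<open>A\<close> with maximal ideal \<open>M\<close> is the inverse limit of the
  \<open>A/M^n\<close>. Elements of the quotients are cosets, and the transition map sends a coset of
  \<open>M^(n+1)\<close> to the coset of \<open>M^n\<close> containing it.\<close>

abbreviation mod_power :: "('a, 'b) ring_scheme \<Rightarrow> nat \<Rightarrow> 'a set ring" where
  "mod_power A n \<equiv> A Quot ideal_power A (max_ideal A) n"

definition completion :: "('a, 'b) ring_scheme \<Rightarrow> (nat \<Rightarrow> 'a set) ring" where
  "completion A =
     \<lparr>carrier = {s. (\<forall>n. s n \<in> carrier (mod_power A n)) \<and> (\<forall>n. s (Suc n) \<subseteq> s n)},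
      monoid.mult = (\<lambda>s t n. s n \<otimes>\<^bsub>mod_power A n\<^esub> t n),
      one = (\<lambda>n. \<one>\<^bsub>mod_power A n\<^esub>),
      ring.zero = (\<lambda>n. \<zero>\<^bsub>mod_power A n\<^esub>),
      add = (\<lambda>s t n. s n \<oplus>\<^bsub>mod_power A n\<^esub> t n)\<rparr>"

definition to_completion :: "('a, 'b) ring_scheme \<Rightarrow> 'a \<Rightarrow> nat \<Rightarrow> 'a set" where
  "to_completion A a = (\<lambda>n. ideal_power A (max_ideal A) n +>\<^bsub>A\<^esub> a)"

definition complete_local_ring :: "('a, 'b) ring_scheme \<Rightarrow> bool" where
  "complete_local_ring A \<longleftrightarrow>
     local_ring A \<and> bij_betw (to_completion A) (carrier A) (carrier (completion A))"

text \<open>The ring \<open>A[[x,y]]\<close>; \<open>p i j\<close> is the coefficient of \<open>x^i y^j\<close>.\<close>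

definition power_series2 :: "('a, 'b) ring_scheme \<Rightarrow> (nat \<Rightarrow> nat \<Rightarrow> 'a) ring" where
  "power_series2 A =
     \<lparr>carrier = {p. \<forall>i j. p i j \<in> carrier A},
      monoid.mult = (\<lambda>p q i j.
        finsum A (\<lambda>(a, b). p a b \<otimes>\<^bsub>A\<^esub> q (i - a) (j - b)) ({..i} \<times> {..j})),
      one = (\<lambda>i j. if i = 0 \<and> j = 0 then \<one>\<^bsub>A\<^esub> else \<zero>\<^bsub>A\<^esub>),
      ring.zero = (\<lambda>i j. \<zero>\<^bsub>A\<^esub>),
      add = (\<lambda>p q i j. p i j \<oplus>\<^bsub>A\<^esub> q i j)\<rparr>"

definition const_series2 :: "('a, 'b) ring_scheme \<Rightarrow> 'a \<Rightarrow> nat \<Rightarrow> nat \<Rightarrow> 'a" where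
  "const_series2 A c = (\<lambda>i j. if i = 0 \<and> j = 0 then c else \<zero>\<^bsub>A\<^esub>)"

definition X_series2 :: "('a, 'b) ring_scheme \<Rightarrow> nat \<Rightarrow> nat \<Rightarrow> 'a" where
  "X_series2 A = (\<lambda>i j. if i = 1 \<and> j = 0 then \<one>\<^bsub>A\<^esub> else \<zero>\<^bsub>A\<^esub>)"

definition Y_series2 :: "('a, 'b) ring_scheme \<Rightarrow> nat \<Rightarrow> nat \<Rightarrow> 'a" where
  "Y_series2 A = (\<lambda>i j. if i = 0 \<and> j = 1 then \<one>\<^bsub>A\<^esub> else \<zero>\<^bsub>A\<^esub>)"

text \<open>The ring \<open>A[[x,y]]/(xy - c)\<close>.\<close>

definition node_ideal :: "('a, 'b) ring_scheme \<Rightarrow> 'a \<Rightarrow> (nat \<Rightarrow> nat \<Rightarrow> 'a) set" where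
  "node_ideal A c =
     genideal (power_series2 A)
       {(X_series2 A \<otimes>\<^bsub>power_series2 A\<^esub> Y_series2 A)
          \<ominus>\<^bsub>power_series2 A\<^esub> const_series2 A c}"

definition node_ring :: "('a, 'b) ring_scheme \<Rightarrow> 'a \<Rightarrow> (nat \<Rightarrow> nat \<Rightarrow> 'a) set ring" where
  "node_ring A c = power_series2 A Quot node_ideal A c"

definition to_node_ring ::
    "('a, 'b) ring_scheme \<Rightarrow> 'a \<Rightarrow> 'a \<Rightarrow> (nat \<Rightarrow> nat \<Rightarrow> 'a) set" where
  "to_node_ring A c a = node_ideal A c +>\<^bsub>power_series2 A\<^esub> const_series2 A a"

text \<open>\<open>A\<close> and \<open>B\<close> are isomorphic as algebras over a ring with carrier \<open>R\<close>, the structure maps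
  being \<open>\<alpha>\<close> and \<open>\<beta>\<close>.\<close>

definition algebra_iso ::
    "'r set \<Rightarrow> ('a, 'c) ring_scheme \<Rightarrow> ('r \<Rightarrow> 'a) \<Rightarrow> ('b, 'd) ring_scheme \<Rightarrow> ('r \<Rightarrow> 'b) \<Rightarrow> bool" where
  "algebra_iso R A \<alpha> B \<beta> \<longleftrightarrow> (\<exists>\<phi>\<in>ring_iso A B. \<forall>r\<in>R. \<phi> (\<alpha> r) = \<beta> r)"


section \<open>The base field\<close>

text \<open>The type \<^typ>\<open>'f\<close> plays the role of the function field \<open>K(C)\<close>; the base field \<open>K\<close> and its
  valuation ring \<open>R\<close> are subsets of it.\<close>

abbreviation residue_field :: "'f::field set \<Rightarrow> 'f set ring" where
  "residue_field R \<equiv> sub_ring R Quot max_ideal (sub_ring R)"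

definition complete_discretely_valued_field ::
    "'f::field set \<Rightarrow> 'f set \<Rightarrow> 'f \<Rightarrow> bool" where
  "complete_discretely_valued_field K R \<pi> \<longleftrightarrow>
     subfield K ring_of_type_algebra \<and>
     K = {a / b | a b. a \<in> R \<and> b \<in> R \<and> b \<noteq> 0} \<and>
     dvr (sub_ring R) \<and> complete_local_ring (sub_ring R) \<and> uniformizer (sub_ring R) \<pi>"


section \<open>Integral projective schemes\<close>

text \<open>An integral separated scheme with function field inside a field \<open>L\<close> is encoded, following
  Zariski and Chevalley, by the set of its local rings, which are subrings of \<open>L\<close>. A point of the
  scheme is identified with its local ring; the generic point is the function field itself.\<close>

type_synonym 'f point = "'f set"
type_synonym 'f scheme = "'f point set"

definition localization :: "'f::field set \<Rightarrow> 'f set \<Rightarrow> 'f set" where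
  "localization A P = {a / b | a b. a \<in> A \<and> b \<in> A - P}"

definition affine_scheme :: "'f::field set \<Rightarrow> 'f scheme" where
  "affine_scheme A = {localization A P | P. primeideal P (sub_ring A)}"

text \<open>The integral closed subscheme of projective space over \<open>A\<close> with homogeneous coordinates
  \<open>G\<close> (a finite set of elements of the field): its standard charts are the spectra of
  \<open>A[g/h | g \<in> G]\<close> for \<open>h \<in> G\<close> nonzero.\<close>

definition proj_scheme :: "'f::field set \<Rightarrow> 'f set \<Rightarrow> 'f scheme" where
  "proj_scheme A G =
     (\<Union>h\<in>G - {0}. affine_scheme (generate_ring ring_of_type_algebra (A \<union> {g / h | g. g \<in> G})))"

text \<open>Integral projective \<open>A\<close>-schemes with function field the whole type.\<close>

definition projective_scheme :: "'f::field set \<Rightarrow> 'f scheme \<Rightarrow> bool" where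
  "projective_scheme A \<C> \<longleftrightarrow> (\<exists>G. finite G \<and> \<C> = proj_scheme A G) \<and> UNIV \<in> \<C>"

text \<open>The domains of definition of rational functions form a subbasis of the Zariski topology of
  an integral separated scheme.\<close>

definition zariski :: "'f scheme \<Rightarrow> 'f point topology" where
  "zariski \<C> = topology_generated_by {{x \<in> \<C>. f \<in> x} | f. True}"

definition irreducible_subset :: "'a topology \<Rightarrow> 'a set \<Rightarrow> bool" where
  "irreducible_subset T Z \<longleftrightarrow> Z \<subseteq> topspace T \<and> Z \<noteq> {} \<and>
     (\<forall>A B. closedin T A \<and> closedin T B \<and> Z \<subseteq> A \<union> B \<longrightarrow> Z \<subseteq> A \<or> Z \<subseteq> B)"

definition generic_point :: "'f scheme \<Rightarrow> 'f point set \<Rightarrow> 'f point \<Rightarrow> bool" where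
  "generic_point \<C> Z \<eta> \<longleftrightarrow> \<eta> \<in> \<C> \<and> zariski \<C> closure_of {\<eta>} = Z"

definition regular_scheme :: "'f::field scheme \<Rightarrow> bool" where
  "regular_scheme \<C> \<longleftrightarrow> (\<forall>x\<in>\<C>. regular_local_ring (sub_ring x))"

definition scheme_dim :: "'f::field scheme \<Rightarrow> nat \<Rightarrow> bool" where
  "scheme_dim \<C> d \<longleftrightarrow> (\<exists>x\<in>\<C>. has_krull_dim (sub_ring x) d) \<and>
     (\<forall>x\<in>\<C>. \<exists>e\<le>d. has_krull_dim (sub_ring x) e)"

text \<open>The point \<open>x'\<close> lies over \<open>x\<close> under the canonical birational correspondence. The identity of
  the function field extends to a morphism \<open>\<C>' \<rightarrow> \<C>\<close> iff every point of \<open>\<C>'\<close> lies over some point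
  of \<open>\<C>\<close>, which is then its image.\<close>

definition lies_over :: "'f::field point \<Rightarrow> 'f point \<Rightarrow> bool" where
  "lies_over x' x \<longleftrightarrow> x \<subseteq> x' \<and> max_ideal (sub_ring x) \<subseteq> max_ideal (sub_ring x')"

definition birational_morphism :: "'f::field scheme \<Rightarrow> 'f scheme \<Rightarrow> bool" where
  "birational_morphism \<C>' \<C> \<longleftrightarrow> (\<forall>x'\<in>\<C>'. \<exists>x\<in>\<C>. lies_over x' x)"


section \<open>Curves and models\<close>

text \<open>The algebraic closure of the subfield \<open>K\<close>, inside the algebraic closure of the type.\<close>

definition closure_of_subfield :: "'f::field set \<Rightarrow> 'f alg_closure set" where
  "closure_of_subfield K =
     {x. \<not> ring.transcendental (ring_of_type_algebra :: 'f alg_closure ring) (to_ac ` K) x}"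

definition linearly_independent_over :: "'f::field set \<Rightarrow> 'f set \<Rightarrow> bool" where
  "linearly_independent_over K B \<longleftrightarrow>
     (\<forall>c. (\<forall>b\<in>B. c b \<in> K) \<and> (\<Sum>b\<in>B. c b * b) = 0 \<longrightarrow> (\<forall>b\<in>B. c b = 0))"

text \<open>The function field and the algebraic closure \<open>L\<close> of \<open>K\<close> are linearly disjoint over \<open>K\<close>,
  that is, their tensor product over \<open>K\<close> injects into the algebraic closure of the function field.
  In characteristic zero a curve with function field \<^typ>\<open>'f\<close> has reduced base change to \<open>L\<close>, so this
  says that the base change is irreducible. In that case the base change of \<open>proj_scheme K G\<close> to
  \<open>L\<close> is \<open>proj_scheme L (to_ac ` G)\<close>, since its charts are obtained by adjoining \<open>L\<close>.\<close>

definition geometrically_irreducible :: "'f::field_char_0 set \<Rightarrow> bool" where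
  "geometrically_irreducible K \<longleftrightarrow>
     (\<forall>B. finite B \<and> linearly_independent_over K B \<longrightarrow>
        linearly_independent_over (closure_of_subfield K) (to_ac ` B))"

text \<open>Smoothness over \<open>K\<close> is regularity of the base change to the algebraic closure.\<close>

definition smooth_proj_geom_irred_curve :: "'f::field_char_0 set \<Rightarrow> 'f scheme \<Rightarrow> bool" where
  "smooth_proj_geom_irred_curve K C \<longleftrightarrow>
     scheme_dim C 1 \<and> UNIV \<in> C \<and> geometrically_irreducible K \<and>
     (\<exists>G. finite G \<and> C = proj_scheme K G \<and>
        regular_scheme (proj_scheme (closure_of_subfield K) (to_ac ` G)))"

text \<open>Flatness over \<open>R\<close> is automatic, since the local rings are domains containing \<open>R\<close>. The generic
  fibre consists of the points at which \<open>\<pi>\<close> is invertible.\<close>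

definition model :: "'f::field set \<Rightarrow> 'f \<Rightarrow> 'f scheme \<Rightarrow> 'f scheme \<Rightarrow> bool" where
  "model R \<pi> C \<C> \<longleftrightarrow> projective_scheme R \<C> \<and> {x \<in> \<C>. \<pi> \<in> Units (sub_ring x)} = C"

definition special_fibre :: "'f::field \<Rightarrow> 'f scheme \<Rightarrow> 'f point set" where
  "special_fibre \<pi> \<C> = {x \<in> \<C>. \<pi> \<in> max_ideal (sub_ring x)}"

text \<open>The local ring of the special fibre at \<open>x\<close>.\<close>

abbreviation special_local_ring :: "'f::field \<Rightarrow> 'f point \<Rightarrow> 'f set ring" where
  "special_local_ring \<pi> x \<equiv> sub_ring x Quot genideal (sub_ring x) {\<pi>}"

definition closed_point :: "'f scheme \<Rightarrow> 'f point \<Rightarrow> bool" where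
  "closed_point \<C> x \<longleftrightarrow> x \<in> \<C> \<and> closedin (zariski \<C>) {x}"

text \<open>The completed local ring of the special fibre is isomorphic to \<open>k[[x,y]]/(xy)\<close> over the
  residue field \<open>k\<close>; compatibility with the \<open>k\<close>-structures is expressed on representatives in \<open>R\<close>.\<close>

definition ordinary_double_point :: "'f::field set \<Rightarrow> 'f \<Rightarrow> 'f point \<Rightarrow> bool" where
  "ordinary_double_point R \<pi> z \<longleftrightarrow>
     algebra_iso R
       (completion (special_local_ring \<pi> z))
       (\<lambda>r. to_completion (special_local_ring \<pi> z) (genideal (sub_ring z) {\<pi>} +>\<^bsub>sub_ring z\<^esub> r))
       (node_ring (residue_field R) \<zero>\<^bsub>residue_field R\<^esub>)
       (\<lambda>r. to_node_ring (residue_field R) \<zero>\<^bsub>residue_field R\<^esub>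
              (max_ideal (sub_ring R) +>\<^bsub>sub_ring R\<^esub> r))"

text \<open>The special fibre is reduced and has at most ordinary double points as singularities. Its
  regular points are smooth points, the residue field being algebraically closed.\<close>

definition semistable_model :: "'f::field set \<Rightarrow> 'f \<Rightarrow> 'f scheme \<Rightarrow> 'f scheme \<Rightarrow> bool" where
  "semistable_model R \<pi> C \<C> \<longleftrightarrow> model R \<pi> C \<C> \<and>
     (\<forall>x\<in>special_fibre \<pi> \<C>. reduced_ring (special_local_ring \<pi> x)) \<and>
     (\<forall>x\<in>special_fibre \<pi> \<C>. closed_point \<C> x \<longrightarrow>
        regular_local_ring (special_local_ring \<pi> x) \<or> ordinary_double_point R \<pi> x)"

type_synonym 'f component = "'f point set"

text \<open>The irreducible components of the special fibre.\<close>

definition components :: "'f::field \<Rightarrow> 'f scheme \<Rightarrow> 'f component set" where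
  "components \<pi> \<C> =
     {\<Gamma>. irreducible_subset (zariski \<C>) \<Gamma> \<and> \<Gamma> \<subseteq> special_fibre \<pi> \<C> \<and>
         (\<forall>Z. irreducible_subset (zariski \<C>) Z \<and> Z \<subseteq> special_fibre \<pi> \<C> \<and> \<Gamma> \<subseteq> Z \<longrightarrow> Z = \<Gamma>)}"

text \<open>A component with generic point \<open>\<eta>\<close>, with its reduced structure, has at \<open>x\<close> the local ring
  obtained by dividing out the functions vanishing at \<open>\<eta>\<close>. Since the residue field is
  algebraically closed, smoothness is regularity of all these rings.\<close>

definition smooth_component :: "'f::field scheme \<Rightarrow> 'f component \<Rightarrow> bool" where
  "smooth_component \<C> \<Gamma> \<longleftrightarrow>
     (\<forall>\<eta>. generic_point \<C> \<Gamma> \<eta> \<longrightarrow>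
        (\<forall>x\<in>\<Gamma>. regular_local_ring (sub_ring x Quot (x \<inter> max_ideal (sub_ring \<eta>)))))"

definition strongly_semistable_model ::
    "'f::field set \<Rightarrow> 'f \<Rightarrow> 'f scheme \<Rightarrow> 'f scheme \<Rightarrow> bool" where
  "strongly_semistable_model R \<pi> C \<C> \<longleftrightarrow>
     semistable_model R \<pi> C \<C> \<and> (\<forall>\<Gamma>\<in>components \<pi> \<C>. smooth_component \<C> \<Gamma>)"

definition desingularization :: "'f::field set \<Rightarrow> 'f scheme \<Rightarrow> 'f scheme \<Rightarrow> bool" where
  "desingularization R \<C> \<C>' \<longleftrightarrow>
     projective_scheme R \<C>' \<and> regular_scheme \<C>' \<and> birational_morphism \<C>' \<C>"

definition minimal_desingularization :: "'f::field set \<Rightarrow> 'f scheme \<Rightarrow> 'f scheme \<Rightarrow> bool" where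
  "minimal_desingularization R \<C> \<C>' \<longleftrightarrow> desingularization R \<C> \<C>' \<and>
     (\<forall>\<C>''. desingularization R \<C> \<C>'' \<longrightarrow> birational_morphism \<C>'' \<C>')"


section \<open>The dual intersection graph\<close>

text \<open>An edge is an intersection point together with its set of two endpoints. The vertices of the
  graph are the components.\<close>

type_synonym 'f edge = "'f point \<times> 'f component set"

definition dual_edges :: "'f::field \<Rightarrow> 'f scheme \<Rightarrow> 'f edge set" where
  "dual_edges \<pi> \<C> =
     {(z, {\<Gamma>, \<Gamma>'}) | z \<Gamma> \<Gamma>'. \<Gamma> \<in> components \<pi> \<C> \<and> \<Gamma>' \<in> components \<pi> \<C> \<and> \<Gamma> \<noteq> \<Gamma>' \<and> z \<in> \<Gamma> \<inter> \<Gamma>'}"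

definition edge_length :: "'f::field set \<Rightarrow> 'f \<Rightarrow> 'f edge \<Rightarrow> nat" where
  "edge_length R \<pi> e =
     (THE n. n \<ge> 1 \<and>
        algebra_iso R
          (completion (sub_ring (fst e))) (to_completion (sub_ring (fst e)))
          (node_ring (sub_ring R) (\<pi> ^ n)) (to_node_ring (sub_ring R) (\<pi> ^ n)))"

text \<open>The valuation at the generic point of a component, normalized by \<open>v(\<pi>) = 1\<close>.\<close>

definition component_val :: "'f::field \<Rightarrow> 'f scheme \<Rightarrow> 'f component \<Rightarrow> 'f \<Rightarrow> real" where
  "component_val \<pi> \<C> \<Gamma> f =
     (let \<eta> = (THE \<eta>. generic_point \<C> \<Gamma> \<eta>) in of_int (dvr_ord \<eta> f) / of_int (dvr_ord \<eta> \<pi>))"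

text \<open>No condition links the two fields: an edge may be present without its endpoints.\<close>

record 'f subgraph =
  sg_vertices :: "'f component set"
  sg_edges :: "'f edge set"

definition is_subgraph :: "'f::field \<Rightarrow> 'f scheme \<Rightarrow> 'f subgraph \<Rightarrow> bool" where
  "is_subgraph \<pi> \<C> T \<longleftrightarrow> sg_vertices T \<subseteq> components \<pi> \<C> \<and> sg_edges T \<subseteq> dual_edges \<pi> \<C>"

definition complete_subgraph :: "'f subgraph \<Rightarrow> 'f subgraph" where
  "complete_subgraph T =
     \<lparr>sg_vertices = sg_vertices T \<union> (\<Union>e\<in>sg_edges T. snd e), sg_edges = sg_edges T\<rparr>"

text \<open>Points of the metrized graph of a regular model: vertices, and interior points of the edges.
  The open edge is identified with the open unit interval after a choice of orientation.\<close>

datatype 'f graph_point = Vertex "'f component" | Interior "'f edge" real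

definition edge_ends :: "'f edge \<Rightarrow> 'f component \<times> 'f component" where
  "edge_ends e = (SOME (\<Gamma>, \<Gamma>'). snd e = {\<Gamma>, \<Gamma>'})"

definition subgraph_image :: "'f subgraph \<Rightarrow> 'f graph_point set" where
  "subgraph_image T =
     Vertex ` sg_vertices T \<union> {Interior e t | e t. e \<in> sg_edges T \<and> 0 < t \<and> t < 1}"

fun normalized_laplacian :: "'f::field \<Rightarrow> 'f scheme \<Rightarrow> 'f \<Rightarrow> 'f graph_point \<Rightarrow> real" where
  "normalized_laplacian \<pi> \<C> f (Vertex \<Gamma>) = component_val \<pi> \<C> \<Gamma> f"
| "normalized_laplacian \<pi> \<C> f (Interior e t) =
     (case edge_ends e of (\<Gamma>, \<Gamma>') \<Rightarrow>
        (1 - t) * component_val \<pi> \<C> \<Gamma> f + t * component_val \<pi> \<C> \<Gamma>' f)"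

text \<open>For a birational morphism \<open>\<C>' \<rightarrow> \<C>\<close>, the strict transform of a component is the component of
  \<open>\<C>'\<close> having the same generic point (i.e. the same local ring).\<close>

definition strict_transform ::
    "'f scheme \<Rightarrow> 'f scheme \<Rightarrow> 'f component \<Rightarrow> 'f component \<Rightarrow> bool" where
  "strict_transform \<C> \<C>' \<Gamma> \<Gamma>' \<longleftrightarrow> (\<exists>\<eta>. generic_point \<C> \<Gamma> \<eta> \<and> generic_point \<C>' \<Gamma>' \<eta>)"

text \<open>The edge \<open>e\<close> of length \<open>n\<close> of the dual graph of \<open>\<C>\<close> is subdivided in the dual graph of \<open>\<C>'\<close>
  into the \<open>n\<close> edges \<open>es\<close>, passing through the \<open>n + 1\<close> vertices \<open>\<Gamma>s\<close>; everything except the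
  two extremal vertices lies over the intersection point of \<open>e\<close>.\<close>

definition subdivides ::
    "'f::field set \<Rightarrow> 'f \<Rightarrow> 'f scheme \<Rightarrow> 'f scheme \<Rightarrow> 'f edge \<Rightarrow>
     'f component list \<Rightarrow> 'f edge list \<Rightarrow> bool" where
  "subdivides R \<pi> \<C> \<C>' e \<Gamma>s es \<longleftrightarrow>
     length es = edge_length R \<pi> e \<and> length \<Gamma>s = Suc (length es) \<and>
     distinct \<Gamma>s \<and> set \<Gamma>s \<subseteq> components \<pi> \<C>' \<and>
     (\<exists>\<Gamma> \<Gamma>'. snd e = {\<Gamma>, \<Gamma>'} \<and>
        strict_transform \<C> \<C>' \<Gamma> (hd \<Gamma>s) \<and> strict_transform \<C> \<C>' \<Gamma>' (last \<Gamma>s)) \<and>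
     (\<forall>i. 0 < i \<and> i < length es \<longrightarrow> (\<forall>x\<in>\<Gamma>s ! i. lies_over x (fst e))) \<and>
     (\<forall>i<length es. es ! i \<in> dual_edges \<pi> \<C>' \<and> snd (es ! i) = {\<Gamma>s ! i, \<Gamma>s ! Suc i} \<and>
        lies_over (fst (es ! i)) (fst e))"

text \<open>\<open>T'\<close> is the subgraph of the dual graph of the minimal desingularization \<open>\<C>'\<close> induced by \<open>T\<close>: each edge
  of \<open>T\<close> is replaced by its subdivision, including the new vertices but not the extremal ones.\<close>

definition induced_subgraph ::
    "'f::field set \<Rightarrow> 'f \<Rightarrow> 'f scheme \<Rightarrow> 'f scheme \<Rightarrow> 'f subgraph \<Rightarrow> 'f subgraph \<Rightarrow> bool" where
  "induced_subgraph R \<pi> \<C> \<C>' T T' \<longleftrightarrow>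
     (\<exists>\<Gamma>s es. (\<forall>e\<in>sg_edges T. subdivides R \<pi> \<C> \<C>' e (\<Gamma>s e) (es e)) \<and>
        sg_vertices T' =
          {\<Gamma>'\<in>components \<pi> \<C>'. \<exists>\<Gamma>\<in>sg_vertices T. strict_transform \<C> \<C>' \<Gamma> \<Gamma>'} \<union>
          (\<Union>e\<in>sg_edges T. set (butlast (tl (\<Gamma>s e)))) \<and>
        sg_edges T' = (\<Union>e\<in>sg_edges T. set (es e)))"


section \<open>Weierstrass equations\<close>

text \<open>The equation \<open>y^2 + a1 x y + a3 y = x^3 + a2 x^2 + a4 x + a6\<close>.\<close>

record 'f weierstrass =
  wa1 :: 'f
  wa2 :: 'f
  wa3 :: 'f
  wa4 :: 'f
  wa6 :: 'f

definition discriminant :: "'f::field weierstrass \<Rightarrow> 'f" where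
  "discriminant W =
     (let b2 = wa1 W ^ 2 + 4 * wa2 W;
          b4 = 2 * wa4 W + wa1 W * wa3 W;
          b6 = wa3 W ^ 2 + 4 * wa6 W;
          b8 = wa1 W ^ 2 * wa6 W + 4 * wa2 W * wa6 W - wa1 W * wa3 W * wa4 W
               + wa2 W * wa3 W ^ 2 - wa4 W ^ 2
      in - (b2 ^ 2) * b8 - 8 * b4 ^ 3 - 27 * b6 ^ 2 + 9 * b2 * b4 * b6)"

text \<open>An elliptic curve is given by one of its Weierstrass equations. The others arise
  by the substitutions \<open>x = u^2 x' + r\<close>, \<open>y = u^3 y' + u^2 s x' + t\<close> with \<open>u\<close> nonzero.\<close>

definition elliptic_curve :: "'f::field weierstrass \<Rightarrow> bool" where
  "elliptic_curve E \<longleftrightarrow> discriminant E \<noteq> 0"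

definition weierstrass_equation_of :: "'f::field weierstrass \<Rightarrow> 'f weierstrass \<Rightarrow> bool" where
  "weierstrass_equation_of E W \<longleftrightarrow>
     (\<exists>u r s t. u \<noteq> 0 \<and>
        u * wa1 W = wa1 E + 2 * s \<and>
        u ^ 2 * wa2 W = wa2 E - s * wa1 E + 3 * r - s ^ 2 \<and>
        u ^ 3 * wa3 W = wa3 E + r * wa1 E + 2 * t \<and>
        u ^ 4 * wa4 W = wa4 E - s * wa3 E + 2 * r * wa2 E - (t + r * s) * wa1 E
                        + 3 * r ^ 2 - 2 * s * t \<and>
        u ^ 6 * wa6 W = wa6 E + r * wa4 E + r ^ 2 * wa2 E + r ^ 3 - t * wa3 E - t ^ 2
                        - r * t * wa1 E)"

text \<open>The disjunct for zero reflects the convention \<open>v(0) = \<infinity>\<close>.\<close>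

definition integral_at :: "'f::field \<Rightarrow> 'f scheme \<Rightarrow> 'f component \<Rightarrow> 'f weierstrass \<Rightarrow> bool" where
  "integral_at \<pi> \<C> \<Gamma> W \<longleftrightarrow>
     (\<forall>a\<in>{wa1 W, wa2 W, wa3 W, wa4 W, wa6 W}. a = 0 \<or> component_val \<pi> \<C> \<Gamma> a \<ge> 0)"

text \<open>Here \<open>S\<close> is the set of valuations at the components of the special fibre of \<open>\<C>\<close>.\<close>

definition S_minimal_model ::
    "'f::field \<Rightarrow> 'f scheme \<Rightarrow> 'f weierstrass \<Rightarrow> 'f weierstrass \<Rightarrow> bool" where
  "S_minimal_model \<pi> \<C> E W \<longleftrightarrow> weierstrass_equation_of E W \<and>
     (\<forall>\<Gamma>\<in>components \<pi> \<C>. integral_at \<pi> \<C> \<Gamma> W \<and>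
        (\<forall>W'. weierstrass_equation_of E W' \<and> integral_at \<pi> \<C> \<Gamma> W' \<longrightarrow>
           component_val \<pi> \<C> \<Gamma> (discriminant W) \<le> component_val \<pi> \<C> \<Gamma> (discriminant W')))"


section \<open>Good reduction on a subgraph\<close>

definition good_reduction_regular ::
    "'f::field \<Rightarrow> 'f scheme \<Rightarrow> 'f weierstrass \<Rightarrow> 'f subgraph \<Rightarrow> bool" where
  "good_reduction_regular \<pi> \<C> E T \<longleftrightarrow>
     (\<exists>W. S_minimal_model \<pi> \<C> E W \<and>
        (\<forall>p\<in>subgraph_image T. normalized_laplacian \<pi> \<C> (discriminant W) p = 0))"

definition good_reduction ::
    "'f::field set \<Rightarrow> 'f \<Rightarrow> 'f scheme \<Rightarrow> 'f weierstrass \<Rightarrow> 'f subgraph \<Rightarrow> bool" where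
  "good_reduction R \<pi> \<C> E T \<longleftrightarrow>
     (if regular_scheme \<C> then good_reduction_regular \<pi> \<C> E T
      else \<exists>\<C>' T'. minimal_desingularization R \<C> \<C>' \<and> induced_subgraph R \<pi> \<C> \<C>' T T' \<and>
             good_reduction_regular \<pi> \<C>' E T')"

end

theory Submission
  imports Defs
begin

text \<open>On an edge of the dual graph of a regular model the function \<open>\<phi>\<^sub>\<Delta>\<close> is affine, so if it
  vanishes on the open edge then it vanishes at both ends
  (\<open>zero_at_ends_if_zero_on_open_edge\<close>): the very \<open>S\<close>-minimal model that shows good reduction on \<open>T\<close>
  shows it on the complete subgraph. This settles regular \<open>\<C>\<close>.

  If \<open>\<C>\<close> is not regular, let \<open>\<C>'\<close> be the minimal desingularization and \<open>T'\<close> the subgraph induced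
  by \<open>T\<close>. The subgraph induced by the completion of \<open>T\<close> has the edges of \<open>T'\<close> and, besides the
  vertices of \<open>T'\<close>, only strict transforms of endpoints of edges of \<open>T\<close>. Points are determined by
  their closures, so a component has at most one strict transform
  (\<open>strict_transform_unique\<close>), namely an extremal vertex of the subdivided edge. Distinct components
  have distinct strict transforms (\<open>strict_transform_inj\<close>), so the subdivision consists of at least
  one edge, and its extremal vertices are ends of edges of \<open>T'\<close>
  (\<open>strict_transform_of_end_in_subdivision\<close>). The regular argument then applies
  on \<open>\<C>'\<close>.\<close>

text \<open>The Zariski topology is T0, because a point, being a local ring, is determined by the
  functions defined at it, and these domains of definition are open.\<close>

lemma generic_point_unique:
  assumes "generic_point \<C> Z \<eta>" and "generic_point \<C> Z \<eta>'"
  shows "\<eta> = \<eta>'"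
proof -
  have sub: "x \<subseteq> y"
    if "x \<in> \<C>" and "y \<in> \<C>" and cl: "zariski \<C> closure_of {x} = zariski \<C> closure_of {y}" for x y
  proof
    fix f assume "f \<in> x"
    have op: "openin (zariski \<C>) {z \<in> \<C>. f \<in> z}"
      unfolding zariski_def by (rule topology_generated_by_Basis) blast
    have x: "x \<in> {z \<in> \<C>. f \<in> z}" using \<open>x \<in> \<C>\<close> \<open>f \<in> x\<close> by simp
    have "x \<in> topspace (zariski \<C>)" using openin_subset[OF op] x by blast
    then have "x \<in> zariski \<C> closure_of {x}" by (simp add: in_closure_of)
    then have "x \<in> zariski \<C> closure_of {y}" using cl by simp
    then have "\<forall>U. x \<in> U \<and> openin (zariski \<C>) U \<longrightarrow> (\<exists>w\<in>{y}. w \<in> U)"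
      by (simp add: in_closure_of)
    then have "\<exists>w\<in>{y}. w \<in> {z \<in> \<C>. f \<in> z}" using op x by (elim allE impE) (rule conjI)
    then show "f \<in> y" by simp
  qed
  have "\<eta> \<in> \<C>" "\<eta>' \<in> \<C>" "zariski \<C> closure_of {\<eta>} = zariski \<C> closure_of {\<eta>'}"
    using assms by (simp_all add: generic_point_def)
  then show ?thesis using sub[of \<eta> \<eta>'] sub[of \<eta>' \<eta>] by (metis subset_antisym)
qed

lemma strict_transform_unique:
  assumes "strict_transform \<C> \<C>' \<Gamma> \<Delta>" and "strict_transform \<C> \<C>' \<Gamma> \<Delta>'"
  shows "\<Delta> = \<Delta>'"
proof -
  obtain \<eta> \<eta>' where gen: "generic_point \<C> \<Gamma> \<eta>" "generic_point \<C> \<Gamma> \<eta>'"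
    and gen': "generic_point \<C>' \<Delta> \<eta>" "generic_point \<C>' \<Delta>' \<eta>'"
    using assms unfolding strict_transform_def by blast
  have "\<eta> = \<eta>'" by (rule generic_point_unique[OF gen])
  then show ?thesis using gen' by (simp add: generic_point_def)
qed

lemma strict_transform_inj:
  assumes "strict_transform \<C> \<C>' \<Gamma> \<Delta>" and "strict_transform \<C> \<C>' \<Gamma>' \<Delta>"
  shows "\<Gamma> = \<Gamma>'"
  using assms unfolding strict_transform_def
  by (intro strict_transform_unique[of \<C>' \<C> \<Delta>]) (auto simp: strict_transform_def)

lemma edge_ends_of_dual_edge:
  assumes "e \<in> dual_edges \<pi> \<C>" and "edge_ends e = (\<Gamma>, \<Gamma>')"
  shows "snd e = {\<Gamma>, \<Gamma>'}"
proof -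
  have "\<exists>p. case p of (\<Gamma>, \<Gamma>') \<Rightarrow> snd e = {\<Gamma>, \<Gamma>'}"
    using assms(1) unfolding dual_edges_def by fastforce
  then have "case edge_ends e of (\<Gamma>, \<Gamma>') \<Rightarrow> snd e = {\<Gamma>, \<Gamma>'}"
    unfolding edge_ends_def by (rule someI_ex)
  then show ?thesis using assms(2) by simp
qed

lemma zero_at_ends_if_zero_on_open_edge:
  assumes e: "e \<in> dual_edges \<pi> \<C>" and "\<Gamma> \<in> snd e"
    and zero: "\<And>t. 0 < t \<Longrightarrow> t < 1 \<Longrightarrow> normalized_laplacian \<pi> \<C> f (Interior e t) = 0"
  shows "component_val \<pi> \<C> \<Gamma> f = 0"
proof -
  obtain A B where AB: "edge_ends e = (A, B)" by fastforce
  have "component_val \<pi> \<C> A f = 0 \<and> component_val \<pi> \<C> B f = 0"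
    \<comment> \<open>An affine function with two distinct zeros is zero.\<close>
    using zero[of "1/3"] zero[of "2/3"] AB by simp
  then show ?thesis using edge_ends_of_dual_edge[OF e AB] assms(2) by auto
qed

text \<open>A subdivision with no edge at all would have a single vertex, the strict transform of both
  ends of \<open>e\<close>; the condition that \<open>e\<close> joins distinct components excludes this.\<close>

lemma strict_transform_of_end_in_subdivision:
  assumes e: "e \<in> dual_edges \<pi> \<C>" and sub: "subdivides R \<pi> \<C> \<C>' e \<Gamma>s es"
    and "\<Gamma> \<in> snd e" and st: "strict_transform \<C> \<C>' \<Gamma> \<Gamma>'"
  shows "\<exists>d\<in>set es. d \<in> dual_edges \<pi> \<C>' \<and> \<Gamma>' \<in> snd d"
proof -
  obtain A B where ends: "snd e = {A, B}"
    and stA: "strict_transform \<C> \<C>' A (hd \<Gamma>s)" and stB: "strict_transform \<C> \<C>' B (last \<Gamma>s)"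
    using sub unfolding subdivides_def by (elim exE conjE) (rule that; assumption)
  have len: "length \<Gamma>s = Suc (length es)"
    and es: "\<And>i. i < length es \<Longrightarrow> es ! i \<in> dual_edges \<pi> \<C>' \<and> snd (es ! i) = {\<Gamma>s ! i, \<Gamma>s ! Suc i}"
    using sub unfolding subdivides_def by blast+
  have "\<Gamma>s \<noteq> []" using len by auto
  then have hd: "hd \<Gamma>s = \<Gamma>s ! 0" and last: "last \<Gamma>s = \<Gamma>s ! length es"
    using len by (simp_all add: hd_conv_nth last_conv_nth)
  have "A \<noteq> B" using e ends unfolding dual_edges_def by auto
  have ne: "0 < length es"
  proof (rule ccontr)
    assume "\<not> 0 < length es"
    then have "hd \<Gamma>s = last \<Gamma>s" using hd last by simp
    then show False using strict_transform_inj[OF stA] stB \<open>A \<noteq> B\<close> by simp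
  qed
  have "\<Gamma>' = \<Gamma>s ! 0 \<or> \<Gamma>' = \<Gamma>s ! length es"
    using assms(3) ends strict_transform_unique[OF st] stA stB hd last by auto
  then show ?thesis
  proof
    assume "\<Gamma>' = \<Gamma>s ! 0"
    then show ?thesis using es[OF ne] ne by (intro bexI[of _ "es ! 0"]) auto
  next
    assume "\<Gamma>' = \<Gamma>s ! length es"
    then show ?thesis using es[of "length es - 1"] ne
      by (intro bexI[of _ "es ! (length es - 1)"]) auto
  qed
qed

text \<open>The form of the regular case used on \<open>\<C>\<close> itself and on its desingularization: \<open>T'\<close> may be any
  subgraph between \<open>T\<close> and its completion.\<close>

lemma good_reduction_regular_add_ends:
  assumes "good_reduction_regular \<pi> \<C> E T"
    and edges: "sg_edges T' = sg_edges T"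
    and vertices: "\<And>\<Gamma>. \<Gamma> \<in> sg_vertices T' \<Longrightarrow> \<Gamma> \<in> sg_vertices T \<or>
                        (\<exists>e\<in>sg_edges T. e \<in> dual_edges \<pi> \<C> \<and> \<Gamma> \<in> snd e)"
  shows "good_reduction_regular \<pi> \<C> E T'"
proof -
  obtain W where W: "S_minimal_model \<pi> \<C> E W"
    and zero: "\<And>p. p \<in> subgraph_image T \<Longrightarrow> normalized_laplacian \<pi> \<C> (discriminant W) p = 0"
    using assms(1) unfolding good_reduction_regular_def by blast
  have interior: "normalized_laplacian \<pi> \<C> (discriminant W) (Interior e t) = 0"
    if "e \<in> sg_edges T" "0 < t" "t < 1" for e t
    by (rule zero) (use that in \<open>unfold subgraph_image_def, blast\<close>)
  have vertex: "component_val \<pi> \<C> \<Gamma> (discriminant W) = 0" if "\<Gamma> \<in> sg_vertices T'" for \<Gamma>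
    using vertices[OF that]
  proof
    assume "\<Gamma> \<in> sg_vertices T"
    then show ?thesis using zero[of "Vertex \<Gamma>"] by (simp add: subgraph_image_def)
  next
    assume "\<exists>e\<in>sg_edges T. e \<in> dual_edges \<pi> \<C> \<and> \<Gamma> \<in> snd e"
    then show ?thesis using zero_at_ends_if_zero_on_open_edge interior by blast
  qed
  have "normalized_laplacian \<pi> \<C> (discriminant W) p = 0" if "p \<in> subgraph_image T'" for p
  proof (cases p)
    case (Vertex \<Gamma>)
    then have "\<Gamma> \<in> sg_vertices T'" using that unfolding subgraph_image_def by auto
    then show ?thesis using Vertex vertex by simp
  next
    case (Interior e t)
    then have "e \<in> sg_edges T'" "0 < t" "t < 1" using that unfolding subgraph_image_def by auto
    then show ?thesis using Interior interior edges by blast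
  qed
  then show ?thesis using W unfolding good_reduction_regular_def by blast
qed

theorem lemma4p4:
  fixes K R :: "'f::field_char_0 set" and \<pi> :: 'f
    and C \<C> :: "'f scheme" and E :: "'f weierstrass" and T :: "'f subgraph"
  assumes "complete_discretely_valued_field K R \<pi>"
    and "algebraically_closed (residue_field R)"
    and "smooth_proj_geom_irred_curve K C"
    and "elliptic_curve E"
    and "strongly_semistable_model R \<pi> C \<C>"
    and "is_subgraph \<pi> \<C> T"
    and "good_reduction R \<pi> \<C> E T"
  shows "good_reduction R \<pi> \<C> E (complete_subgraph T)"
proof (cases "regular_scheme \<C>")
  case True
  then have "good_reduction_regular \<pi> \<C> E T" using assms(7) by (simp add: good_reduction_def)
  then have "good_reduction_regular \<pi> \<C> E (complete_subgraph T)"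
    by (rule good_reduction_regular_add_ends)
      (use assms(6) in \<open>auto simp: complete_subgraph_def is_subgraph_def\<close>)
  then show ?thesis using True by (simp add: good_reduction_def)
next
  case False
  let ?T = "complete_subgraph T"
  obtain \<C>' T' where min: "minimal_desingularization R \<C> \<C>'"
    and ind: "induced_subgraph R \<pi> \<C> \<C>' T T'" and good: "good_reduction_regular \<pi> \<C>' E T'"
    using assms(7) False unfolding good_reduction_def by auto
  obtain \<Gamma>s es where sub: "\<forall>e\<in>sg_edges T. subdivides R \<pi> \<C> \<C>' e (\<Gamma>s e) (es e)"
    and vert: "sg_vertices T' =
          {\<Gamma>'\<in>components \<pi> \<C>'. \<exists>\<Gamma>\<in>sg_vertices T. strict_transform \<C> \<C>' \<Gamma> \<Gamma>'} \<union>
          (\<Union>e\<in>sg_edges T. set (butlast (tl (\<Gamma>s e))))"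
    and edges: "sg_edges T' = (\<Union>e\<in>sg_edges T. set (es e))"
    using ind unfolding induced_subgraph_def by (elim exE conjE) (rule that; assumption)
  define T'' where "T'' =
     \<lparr>sg_vertices =
        {\<Gamma>'\<in>components \<pi> \<C>'. \<exists>\<Gamma>\<in>sg_vertices ?T. strict_transform \<C> \<C>' \<Gamma> \<Gamma>'} \<union>
        (\<Union>e\<in>sg_edges T. set (butlast (tl (\<Gamma>s e)))),
      sg_edges = sg_edges T'\<rparr>"
  have "induced_subgraph R \<pi> \<C> \<C>' ?T T''"
    unfolding induced_subgraph_def
  proof (intro exI[of _ \<Gamma>s] exI[of _ es] conjI ballI)
    show "subdivides R \<pi> \<C> \<C>' e (\<Gamma>s e) (es e)" if "e \<in> sg_edges ?T" for e
      using that sub by (simp add: complete_subgraph_def)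
  qed (simp_all add: T''_def edges, simp_all add: complete_subgraph_def)
  moreover have "good_reduction_regular \<pi> \<C>' E T''"
  proof (rule good_reduction_regular_add_ends[OF good])
    show "sg_edges T'' = sg_edges T'" by (simp add: T''_def)
    fix \<Gamma>' assume \<Gamma>': "\<Gamma>' \<in> sg_vertices T''"
    show "\<Gamma>' \<in> sg_vertices T' \<or> (\<exists>d\<in>sg_edges T'. d \<in> dual_edges \<pi> \<C>' \<and> \<Gamma>' \<in> snd d)"
    proof (cases "\<Gamma>' \<in> sg_vertices T'")
      case False
      then obtain \<Gamma> e where e: "e \<in> sg_edges T"
        and is_end: "\<Gamma> \<in> snd e" "strict_transform \<C> \<C>' \<Gamma> \<Gamma>'"
        using \<Gamma>' unfolding vert T''_def complete_subgraph_def by auto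
      have "e \<in> dual_edges \<pi> \<C>" using e assms(6) by (auto simp: is_subgraph_def)
      then obtain d where "d \<in> set (es e)" "d \<in> dual_edges \<pi> \<C>'" "\<Gamma>' \<in> snd d"
        using strict_transform_of_end_in_subdivision[OF _ bspec[OF sub e] is_end] by blast
      then show ?thesis using e unfolding edges by blast
    qed simp
  qed
  ultimately show ?thesis using False min unfolding good_reduction_def by auto
qed

end
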